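(* Let $f:\mathbb R\to\mathbb R$ be a smooth function, let $\alpha\neq0$, $\beta$, $\gamma$ be real constants, and set $F(x,y,z)=f(x)+\alpha e^{2z}+\beta y+\gamma$ on $\mathbb R^3$ with coordinates $(x,y,z)$. Let $(\varphi,\xi,\eta,g)$ be the paracontact metric structure on $\mathbb R^3$ defined by $$\xi=2\partial_z,\qquad \eta=\tfrac12(dz-y\,dx),$$ and, with respect to the basis $\{\partial_x,\partial_y,\partial_z\}$, $$g=\frac14\begin{pmatrix} F & 1 & -y \\ 1 & 0 & 0 \\ -y & 0 & 1 \end{pmatrix},\qquad \varphi=\begin{pmatrix} -1 & 0 & 0 \\ {F}-y^2 & 1 & 0 \\ -y & 0 & 0 \end{pmatrix}.$$ Then $(\mathbb R^3,\varphi,\xi,\eta,g)$ is a paracontact Ricci soliton. Moreover, for any $\beta\neq0$, such a paracontact metric structure is not locally homogeneous.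
   Context: An almost paracontact structure on a connected smooth $3$-manifold is a triple $(\varphi,\xi,\eta)$ of a $(1,1)$-tensor, a global vector field and a $1$-form with $\varphi(\xi)=0$, $\eta\circ\varphi=0$, $\eta(\xi)=1$, $\varphi^2=\mathrm{Id}-\eta\otimes\xi$, and such that the $\pm1$-eigenbundles of $\varphi|_{\ker\eta}$ both have rank $1$. It is a paracontact metric structure together with a pseudo-Riemannian metric $g$ if $g(\varphi X,\varphi Y)=-g(X,Y)+\eta(X)\eta(Y)$ and $d\eta(X,Y)=g(X,\varphi Y)$ for all $X,Y$, with the convention $d\eta(X,Y)=\frac12\big(X\eta(Y)-Y\eta(X)-\eta([X,Y])\big)$. The matrix of $\varphi$ acts on column vectors of components (its columns are the components of $\varphi\partial_x,\varphi\partial_y,\varphi\partial_z$). A paracontact Ricci soliton is a paracontact metric manifold with $\mathcal L_\xi g+\varrho=\lambda g$ for some real constant $\lambda$, where $\varrho$ is the Ricci tensor (standard sign, positive on round spheres). A paracontact metric manifold is locally homogeneous if for any two points there is a local isometry taking one to the other and preserving $\eta$ (hence the whole structure $(\varphi,\xi,\eta,g)$). *)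

theory Defs
  imports "HOL-Analysis.Analysis"
begin

text \<open>
  Tensor fields on the manifold \<open>\<real>\<^sup>3\<close> are given by their components in the global coordinates
  \<open>(x, y, z) = (p $ 1, p $ 2, p $ 3)\<close>: vector fields and 1-forms by column vectors,
  (1,1)-tensors by matrices acting on columns (\<open>\<phi>\<^sub>p v = \<phi> p *v v\<close>), and
  (0,2)-tensors by matrices \<open>b p\<close> with \<open>b\<^sub>p(v, w) = v \<bullet> (b p *v w)\<close>.
\<close>

type_synonym vec_field = "real^3 \<Rightarrow> real^3"
type_synonym one_form = "real^3 \<Rightarrow> real^3"
type_synonym tensor11 = "real^3 \<Rightarrow> real^3^3"
type_synonym tensor02 = "real^3 \<Rightarrow> real^3^3"

subsection \<open>Smoothness\<close>

text \<open>Only meant for open \<open>S\<close>, since derivatives are taken at \<open>x\<close> in the whole space.\<close>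

primrec C_k_on :: "nat \<Rightarrow> 'a::real_normed_vector set \<Rightarrow> ('a \<Rightarrow> 'b::real_normed_vector) \<Rightarrow> bool" where
  "C_k_on 0 S f \<longleftrightarrow> continuous_on S f"
| "C_k_on (Suc k) S f \<longleftrightarrow>
     (\<forall>x\<in>S. f differentiable (at x)) \<and>
     (\<forall>v. C_k_on k S (\<lambda>x. frechet_derivative f (at x) v))"

definition smooth_on :: "'a::real_normed_vector set \<Rightarrow> ('a \<Rightarrow> 'b::real_normed_vector) \<Rightarrow> bool" where
  "smooth_on S f \<longleftrightarrow> (\<forall>k. C_k_on k S f)"

subsection \<open>Calculus of vector fields and forms\<close>

definition form_app :: "one_form \<Rightarrow> real^3 \<Rightarrow> real^3 \<Rightarrow> real" where
  "form_app \<eta> p v = \<eta> p \<bullet> v"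

definition bil_app :: "tensor02 \<Rightarrow> real^3 \<Rightarrow> real^3 \<Rightarrow> real^3 \<Rightarrow> real" where
  "bil_app b p v w = v \<bullet> (b p *v w)"

definition vf_deriv :: "vec_field \<Rightarrow> (real^3 \<Rightarrow> real) \<Rightarrow> real^3 \<Rightarrow> real" where
  "vf_deriv X u p = frechet_derivative u (at p) (X p)"

definition lie_bracket :: "vec_field \<Rightarrow> vec_field \<Rightarrow> vec_field" where
  "lie_bracket X Y p = frechet_derivative Y (at p) (X p) - frechet_derivative X (at p) (Y p)"

text \<open>The convention for \<open>d\<eta>\<close> that includes the factor \<open>1/2\<close>.\<close>

definition ext_deriv :: "one_form \<Rightarrow> vec_field \<Rightarrow> vec_field \<Rightarrow> real^3 \<Rightarrow> real" where
  "ext_deriv \<eta> X Y p = 1/2 *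
     (vf_deriv X (\<lambda>q. form_app \<eta> q (Y q)) p
      - vf_deriv Y (\<lambda>q. form_app \<eta> q (X q)) p
      - form_app \<eta> p (lie_bracket X Y p))"

definition lie_deriv :: "vec_field \<Rightarrow> tensor02 \<Rightarrow> vec_field \<Rightarrow> vec_field \<Rightarrow> real^3 \<Rightarrow> real" where
  "lie_deriv V b X Y p =
     vf_deriv V (\<lambda>q. bil_app b q (X q) (Y q)) p
     - bil_app b p (lie_bracket V X p) (Y p)
     - bil_app b p (X p) (lie_bracket V Y p)"

subsection \<open>Levi-Civita connection and Ricci tensor\<close>

definition pseudo_riemannian :: "tensor02 \<Rightarrow> bool" where
  "pseudo_riemannian g \<longleftrightarrow> smooth_on UNIV g \<and>
     (\<forall>p. transpose (g p) = g p \<and> invertible (g p))"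

definition coord_vf :: "3 \<Rightarrow> vec_field" where
  "coord_vf i = (\<lambda>p. axis i 1)"

text \<open>The Christoffel symbol \<open>\<Gamma>\<^sup>k\<^sub>i\<^sub>j\<close>.\<close>

definition christoffel :: "tensor02 \<Rightarrow> real^3 \<Rightarrow> 3 \<Rightarrow> 3 \<Rightarrow> 3 \<Rightarrow> real" where
  "christoffel g p k i j = 1/2 * (\<Sum>l\<in>UNIV. matrix_inv (g p) $ k $ l *
     (vf_deriv (coord_vf i) (\<lambda>q. g q $ j $ l) p
      + vf_deriv (coord_vf j) (\<lambda>q. g q $ i $ l) p
      - vf_deriv (coord_vf l) (\<lambda>q. g q $ i $ j) p))"

definition levi_civita :: "tensor02 \<Rightarrow> vec_field \<Rightarrow> vec_field \<Rightarrow> vec_field" where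
  "levi_civita g X Y p = frechet_derivative Y (at p) (X p)
     + (\<chi> k. \<Sum>i\<in>UNIV. \<Sum>j\<in>UNIV. christoffel g p k i j * X p $ i * Y p $ j)"

definition curvature :: "tensor02 \<Rightarrow> vec_field \<Rightarrow> vec_field \<Rightarrow> vec_field \<Rightarrow> vec_field" where
  "curvature g X Y Z p =
     levi_civita g X (levi_civita g Y Z) p
     - levi_civita g Y (levi_civita g X Z) p
     - levi_civita g (lie_bracket X Y) Z p"

text \<open>\<open>\<rho>(Y, Z) = tr (X \<mapsto> R(X, Y) Z)\<close>, which is positive on round spheres for the above sign
  of \<open>R\<close>; the components are evaluated on the coordinate fields.\<close>

definition ricci :: "tensor02 \<Rightarrow> tensor02" where
  "ricci g p = (\<chi> j k. trace (\<chi> a i. curvature g (coord_vf i) (coord_vf j) (coord_vf k) p $ a))"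

subsection \<open>Paracontact structures\<close>

definition almost_paracontact :: "tensor11 \<Rightarrow> vec_field \<Rightarrow> one_form \<Rightarrow> bool" where
  "almost_paracontact \<phi> \<xi> \<eta> \<longleftrightarrow>
     smooth_on UNIV \<phi> \<and> smooth_on UNIV \<xi> \<and> smooth_on UNIV \<eta> \<and>
     (\<forall>p. \<phi> p *v \<xi> p = 0 \<and>
          (\<forall>v. form_app \<eta> p (\<phi> p *v v) = 0) \<and>
          form_app \<eta> p (\<xi> p) = 1 \<and>
          (\<forall>v. \<phi> p *v (\<phi> p *v v) = v - form_app \<eta> p v *\<^sub>R \<xi> p) \<and>
          dim {v. form_app \<eta> p v = 0 \<and> \<phi> p *v v = v} = 1 \<and>
          dim {v. form_app \<eta> p v = 0 \<and> \<phi> p *v v = - v} = 1)"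

definition paracontact_metric :: "tensor11 \<Rightarrow> vec_field \<Rightarrow> one_form \<Rightarrow> tensor02 \<Rightarrow> bool" where
  "paracontact_metric \<phi> \<xi> \<eta> g \<longleftrightarrow>
     almost_paracontact \<phi> \<xi> \<eta> \<and> pseudo_riemannian g \<and>
     (\<forall>p v w. bil_app g p (\<phi> p *v v) (\<phi> p *v w)
        = - bil_app g p v w + form_app \<eta> p v * form_app \<eta> p w) \<and>
     (\<forall>X Y. smooth_on UNIV X \<longrightarrow> smooth_on UNIV Y \<longrightarrow>
        (\<forall>p. ext_deriv \<eta> X Y p = bil_app g p (X p) (\<phi> p *v Y p)))"

definition paracontact_ricci_soliton :: "tensor11 \<Rightarrow> vec_field \<Rightarrow> one_form \<Rightarrow> tensor02 \<Rightarrow> bool" where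
  "paracontact_ricci_soliton \<phi> \<xi> \<eta> g \<longleftrightarrow>
     paracontact_metric \<phi> \<xi> \<eta> g \<and>
     (\<exists>c::real. \<forall>X Y. smooth_on UNIV X \<longrightarrow> smooth_on UNIV Y \<longrightarrow>
        (\<forall>p. lie_deriv \<xi> g X Y p + bil_app (ricci g) p (X p) (Y p)
             = c * bil_app g p (X p) (Y p)))"

text \<open>The local isometries are diffeomorphisms \<open>\<Phi> : U \<rightarrow> V\<close> of open sets pulling back \<open>g\<close> to
  \<open>g\<close> and \<open>\<eta>\<close> to \<open>\<eta>\<close>; preservation of \<open>\<xi>\<close> and \<open>\<phi>\<close> follows for paracontact metric structures.\<close>

definition locally_homogeneous :: "one_form \<Rightarrow> tensor02 \<Rightarrow> bool" where
  "locally_homogeneous \<eta> g \<longleftrightarrow>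
     (\<forall>p q. \<exists>U V \<Phi> \<Psi>. open U \<and> open V \<and> p \<in> U \<and> q \<in> V \<and> \<Phi> p = q \<and>
        homeomorphism U V \<Phi> \<Psi> \<and> smooth_on U \<Phi> \<and> smooth_on V \<Psi> \<and>
        (\<forall>x\<in>U. \<forall>v w. bil_app g (\<Phi> x) (frechet_derivative \<Phi> (at x) v) (frechet_derivative \<Phi> (at x) w)
            = bil_app g x v w) \<and>
        (\<forall>x\<in>U. \<forall>v. form_app \<eta> (\<Phi> x) (frechet_derivative \<Phi> (at x) v) = form_app \<eta> x v))"

end

theory Submission
  imports Defs
begin

text \<open>
  That the structure is a Ricci soliton (with constant \<open>- 2\<close>) is a computation: the Ricci tensor is
  \<open>- 2 g\<close> minus the Lie derivative of \<open>g\<close> along \<open>\<xi>\<close>, which is \<open>\<alpha> exp (2 z) dx\<^sup>2\<close>.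

  For the second part let \<open>\<Phi> = (A, B, C)\<close> be a local isometry that preserves \<open>\<eta>\<close>. It also preserves
  \<open>\<xi>\<close>, which is the \<open>g\<close>-dual of \<open>\<eta>\<close>, hence it commutes with vertical translations. Comparing the
  metric at two points of a vertical line shows that \<open>\<Phi>\<close> preserves \<open>exp (2 z) dx\<^sup>2\<close>, so that \<open>A\<close> and
  \<open>C - z\<close> depend on \<open>x\<close> only. Comparing the metric at two points of a line parallel to the \<open>y\<close>-axis then gives
  \<open>\<beta> A\<^sub>x = \<beta>\<close>. For \<open>\<beta> \<noteq> 0\<close> it follows that \<open>A\<^sub>x = 1\<close> and therefore \<open>C = z\<close>: such a \<open>\<Phi>\<close> cannot
  change the height. The argument only uses first derivatives of \<open>\<Phi>\<close>: the second derivatives it would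
  need are difference quotients in the direction of \<open>y\<close>, because \<open>B\<close> is affine in \<open>y\<close>.
\<close>

subsection \<open>Differentiability of vector-valued maps\<close>

lemma bounded_linear_axis: "bounded_linear (axis i :: 'a::real_normed_vector \<Rightarrow> 'a^'n)"
proof (rule bounded_linear_intro[where K = 1])
  show "norm (axis i x :: 'a^'n) \<le> norm x * 1" for x :: 'a
    by (simp add: norm_vec_def L2_set_def axis_def if_distrib[of norm] if_distrib[of "\<lambda>t. t\<^sup>2"]
        cong: if_cong)
qed (auto simp: vec_eq_iff axis_def)

lemma vec_sum_axis: "(\<Sum>i\<in>UNIV. axis i (x $ i)) = (x :: 'a::real_normed_vector^'n)"
  by (simp add: vec_eq_iff axis_def)

text \<open>A vector is the finite sum of its components placed on the axes, and placing on an axis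
  is bounded linear.\<close>

lemma has_derivative_vec_componentwise:
  fixes h :: "'a::real_normed_vector \<Rightarrow> 'b::real_normed_vector^'n"
  assumes "\<And>i. ((\<lambda>q. h q $ i) has_derivative (\<lambda>v. h' v $ i)) F"
  shows "(h has_derivative h') F"
proof -
  have "((\<lambda>q. \<Sum>i\<in>UNIV. axis i (h q $ i)) has_derivative (\<lambda>v. \<Sum>i\<in>UNIV. axis i (h' v $ i))) F"
    by (intro has_derivative_sum bounded_linear.has_derivative[OF bounded_linear_axis] assms)
  then show ?thesis
    by (simp add: vec_sum_axis)
qed

lemma frechet_derivative_eqI:
  "(f has_derivative f') (at x) \<Longrightarrow> frechet_derivative f (at x) = f'"
  by (rule frechet_derivative_at[symmetric])

section \<open>Closure properties of \<open>C_k_on\<close>\<close>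

lemma C_k_on_const: "C_k_on k UNIV (\<lambda>_. c)"
  by (induction k arbitrary: c) auto

lemma C_k_on_add:
  "C_k_on k UNIV f \<Longrightarrow> C_k_on k UNIV g \<Longrightarrow> C_k_on k UNIV (\<lambda>x. f x + g x)"
proof (induction k arbitrary: f g)
  case (Suc k)
  then have d: "f differentiable (at x)" "g differentiable (at x)" for x by auto
  have "frechet_derivative (\<lambda>x. f x + g x) (at x) v
      = frechet_derivative f (at x) v + frechet_derivative g (at x) v" for x v
    by (subst frechet_derivative_eqI[OF has_derivative_add])
       (use d in \<open>auto simp: frechet_derivative_works\<close>)
  with Suc d show ?case by simp
qed (auto intro: continuous_intros)

lemma C_k_on_bounded_linear_comp:
  assumes "bounded_linear L"
  shows "C_k_on k UNIV f \<Longrightarrow> C_k_on k UNIV (\<lambda>x. L (f x))"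
proof (induction k arbitrary: f)
  case 0
  then show ?case using bounded_linear.continuous_on[OF assms] by simp
next
  case (Suc k)
  then have d: "(f has_derivative frechet_derivative f (at x)) (at x)" for x
    by (auto simp: frechet_derivative_works)
  note D = bounded_linear.has_derivative[OF assms d]
  from Suc D show ?case
    by (auto simp: frechet_derivative_eqI[OF D] differentiable_def)
qed

text \<open>The derivative in direction \<open>v\<close> is the derivative of \<open>f\<close> in
  the fixed direction \<open>l v\<close>, again composed with \<open>l\<close>, so the induction
  closes.\<close>

lemma C_k_on_comp_bounded_linear:
  assumes l: "bounded_linear l"
  shows "C_k_on k UNIV f \<Longrightarrow> C_k_on k UNIV (\<lambda>x. f (l x))"
proof (induction k arbitrary: f)
  case 0
  then show ?case
    using continuous_on_compose2[OF _ linear_continuous_on[OF l], of UNIV f UNIV] by simp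
next
  case (Suc k)
  then have d: "(f has_derivative frechet_derivative f (at x)) (at x)" for x
    by (auto simp: frechet_derivative_works)
  have D: "((\<lambda>x. f (l x)) has_derivative (\<lambda>v. frechet_derivative f (at (l x)) (l v))) (at x)" for x
    by (rule has_derivative_compose[OF bounded_linear_imp_has_derivative[OF l] d])
  from Suc D show ?case
    by (auto simp: frechet_derivative_eqI[OF D] differentiable_def)
qed

lemma C_k_on_bounded_linear: "bounded_linear L \<Longrightarrow> C_k_on k UNIV L"
  by (cases k)
     (auto simp: linear_continuous_on C_k_on_const bounded_linear_imp_differentiable
        frechet_derivative_eqI[OF bounded_linear_imp_has_derivative])

lemma C_k_on_sum:
  "finite I \<Longrightarrow> (\<And>i. i \<in> I \<Longrightarrow> C_k_on k UNIV (f i)) \<Longrightarrow> C_k_on k UNIV (\<lambda>x. \<Sum>i\<in>I. f i x)"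
  by (induction I rule: finite_induct) (auto intro: C_k_on_const C_k_on_add)

lemma C_k_on_vec_componentwise:
  fixes h :: "'a::real_normed_vector \<Rightarrow> 'b::real_normed_vector^'n"
  assumes "\<And>i. C_k_on k UNIV (\<lambda>q. h q $ i)"
  shows "C_k_on k UNIV h"
proof -
  have "C_k_on k UNIV (\<lambda>q. \<Sum>i\<in>UNIV. axis i (h q $ i))"
    by (intro C_k_on_sum C_k_on_bounded_linear_comp[OF bounded_linear_axis] assms) simp
  then show ?thesis
    by (simp add: vec_sum_axis)
qed

lemma C_k_on_exp: "C_k_on k UNIV (exp :: real \<Rightarrow> real)"
proof (induction k)
  case (Suc k)
  have "frechet_derivative exp (at x) = (\<lambda>v. v * exp x)" for x :: real
    by (rule frechet_derivative_eqI) (auto intro!: derivative_eq_intros)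
  with Suc show ?case
    by (auto simp: differentiable_def intro!: C_k_on_bounded_linear_comp[OF bounded_linear_mult_right]
         exI[of _ "\<lambda>v. v * exp _"] derivative_eq_intros)
qed (auto intro: continuous_intros)

lemma C_k_on_power2: "C_k_on k UNIV (\<lambda>x::real. x\<^sup>2)"
proof (cases k)
  case (Suc n)
  have D: "((\<lambda>x. x\<^sup>2) has_derivative (\<lambda>v. (2 * v) * x)) (at x)" for x :: real
    by (auto intro!: derivative_eq_intros)
  from D show ?thesis unfolding Suc
    by (auto simp: differentiable_def frechet_derivative_eqI[OF D] intro!: C_k_on_bounded_linear bounded_linear_mult_right)
qed (auto intro: continuous_intros)

lemma smooth_on_differentiable: "smooth_on UNIV h \<Longrightarrow> h differentiable (at x)"
  by (auto simp: smooth_on_def dest: spec[of _ 1])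

section \<open>Inverse matrices and one-dimensional subspaces\<close>

lemma matrix_inv_eqI:
  fixes A B :: "real^'n^'n"
  assumes "A ** B = mat 1"
  shows "matrix_inv A = B"
proof -
  have BA: "B ** A = mat 1" using assms by (simp add: matrix_left_right_inverse)
  then have "A ** matrix_inv A = mat 1"
    using assms unfolding matrix_inv_def by (metis (mono_tags, lifting) someI_ex)
  with BA show ?thesis
    by (metis matrix_mul_assoc matrix_mul_lid matrix_mul_rid)
qed

lemma dim_eq_1I:
  fixes w :: "'a::euclidean_space"
  assumes "w \<noteq> 0" "A = range (\<lambda>c. c *\<^sub>R w)"
  shows "dim A = 1"
  using assms by (simp flip: span_singleton)

text \<open>The derivative of \<open>h (x + r *\<^sub>R v) - r *\<^sub>R c\<close> in
  \<open>r\<close> vanishes. Convexity of \<open>S\<close> makes the parameter set convex, so this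
  function is constant there.\<close>

lemma affine_along_line:
  fixes h :: "'a::real_normed_vector \<Rightarrow> 'b::real_normed_vector"
  assumes "convex S" "x \<in> S" "x + t *\<^sub>R v \<in> S"
    and h: "\<And>y. y \<in> S \<Longrightarrow> (h has_derivative h' y) (at y)"
    and c: "\<And>r. x + r *\<^sub>R v \<in> S \<Longrightarrow> h' (x + r *\<^sub>R v) v = c"
  shows "h (x + t *\<^sub>R v) = h x + t *\<^sub>R c"
proof -
  let ?T = "{r. x + r *\<^sub>R v \<in> S}"
  let ?k = "\<lambda>r. h (x + r *\<^sub>R v) - r *\<^sub>R c"
  have "convex ?T"
  proof (rule convexI)
    fix r s a b :: real
    assume "r \<in> ?T" "s \<in> ?T" and ab: "0 \<le> a" "0 \<le> b" "a + b = 1"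
    then have "a *\<^sub>R (x + r *\<^sub>R v) + b *\<^sub>R (x + s *\<^sub>R v) \<in> S"
      using \<open>convex S\<close> by (intro convexD) auto
    also have "a *\<^sub>R (x + r *\<^sub>R v) + b *\<^sub>R (x + s *\<^sub>R v) = (a + b) *\<^sub>R x + (a * r + b * s) *\<^sub>R v"
      by (simp add: algebra_simps)
    finally show "a *\<^sub>R r + b *\<^sub>R s \<in> ?T"
      by (simp add: ab)
  qed
  moreover have "(?k has_derivative (\<lambda>_. 0)) (at r within ?T)" if "r \<in> ?T" for r
  proof -
    have y: "x + r *\<^sub>R v \<in> S" using that by simp
    have "((\<lambda>r. x + r *\<^sub>R v) has_derivative (\<lambda>s. s *\<^sub>R v)) (at r within ?T)"
      by (auto intro!: derivative_eq_intros)
    from has_derivative_compose[of "\<lambda>r. x + r *\<^sub>R v", OF this h[OF y]]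
    have "((\<lambda>r. h (x + r *\<^sub>R v)) has_derivative (\<lambda>s. h' (x + r *\<^sub>R v) (s *\<^sub>R v))) (at r within ?T)" .
    moreover have "h' (x + r *\<^sub>R v) (s *\<^sub>R v) = s *\<^sub>R c" for s
      using linear_scale[OF has_derivative_linear[OF h[OF y]]] c[OF y] by simp
    ultimately show ?thesis
      by (auto intro!: derivative_eq_intros)
  qed
  ultimately have "\<exists>d. \<forall>r\<in>?T. ?k r = d"
    by (rule has_derivative_zero_constant)
  then obtain d where d: "\<And>r. r \<in> ?T \<Longrightarrow> ?k r = d"
    by blast
  show ?thesis
    using d[of 0] d[of t] assms(2,3) by (simp add: algebra_simps)
qed

lemma has_derivative_translate_arg:
  assumes "(h has_derivative h') (at (x + w))"
  shows "((\<lambda>y. h (y + w)) has_derivative h') (at x)"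
proof -
  have "((\<lambda>y. y + w) has_derivative (\<lambda>v. v)) (at x)"
    by (auto intro!: derivative_eq_intros)
  from has_derivative_compose[OF this assms] show ?thesis .
qed

text \<open>Near \<open>x\<close> the maps \<open>h\<close> and \<open>h (y + w) - c\<close>
  coincide, and derivatives are unique.\<close>

lemma derivative_translate:
  fixes h :: "'a::real_normed_vector \<Rightarrow> 'b::real_normed_vector"
  assumes "open S" "x \<in> S" "x + w \<in> S"
    and h: "\<And>y. y \<in> S \<Longrightarrow> (h has_derivative h' y) (at y)"
    and eq: "\<And>y. y \<in> S \<Longrightarrow> y + w \<in> S \<Longrightarrow> h (y + w) = h y + c"
  shows "h' (x + w) = h' x"
proof -
  let ?T = "S \<inter> (\<lambda>y. y + w) -` S"
  have "open ?T"
    using \<open>open S\<close> by (intro open_Int open_vimage continuous_intros) auto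
  have "((\<lambda>y. h (y + w) - c) has_derivative h' (x + w)) (at x)"
    using has_derivative_translate_arg[OF h[OF \<open>x + w \<in> S\<close>]]
    by (auto intro!: derivative_eq_intros)
  then have "(h has_derivative h' (x + w)) (at x)"
    by (rule has_derivative_transform_within_open[OF _ \<open>open ?T\<close>]) (use assms eq in auto)
  then show ?thesis
    using h[OF \<open>x \<in> S\<close>] has_derivative_unique by blast
qed

lemma open_translate_nonzero:
  fixes v :: "'a::real_normed_vector"
  assumes "open S" "x \<in> S"
  obtains t where "t \<noteq> 0" "x + t *\<^sub>R v \<in> S"
proof -
  have "open ((\<lambda>t. x + t *\<^sub>R v) -` S)"
    using assms by (intro open_vimage continuous_intros)
  then obtain e where "e > 0" "ball 0 e \<subseteq> (\<lambda>t. x + t *\<^sub>R v) -` S"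
    using assms by (force simp: open_contains_ball)
  moreover have "e / 2 \<in> ball 0 e" using \<open>e > 0\<close> by simp
  ultimately have "x + (e / 2) *\<^sub>R v \<in> S" by blast
  with \<open>e > 0\<close> show ?thesis using that[of "e / 2"] by simp
qed

subsection \<open>The paracontact metric structure\<close>

locale walker_structure =
  fixes f :: "real \<Rightarrow> real" and \<alpha> \<beta> \<gamma> :: real
    and F :: "real \<Rightarrow> real \<Rightarrow> real \<Rightarrow> real"
    and \<phi> :: tensor11 and \<xi> :: vec_field and \<eta> :: one_form and g :: tensor02
  assumes f_smooth: "smooth_on UNIV f"
    and \<alpha>_nonzero: "\<alpha> \<noteq> 0"
    and F: "\<And>x y z. F x y z = f x + \<alpha> * exp (2 * z) + \<beta> * y + \<gamma>"
    and \<xi>: "\<And>p. \<xi> p = vector [0, 0, 2]"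
    and \<eta>: "\<And>p. \<eta> p = (1/2) *\<^sub>R vector [- (p $ 2), 0, 1]"
    and g: "\<And>p. g p = (1/4) *\<^sub>R vector
              [vector [F (p $ 1) (p $ 2) (p $ 3), 1, - (p $ 2)],
               vector [1, 0, 0],
               vector [- (p $ 2), 0, 1]]"
    and \<phi>: "\<And>p. \<phi> p = vector
              [vector [- 1, 0, 0],
               vector [F (p $ 1) (p $ 2) (p $ 3) - (p $ 2)^2, 1, 0],
               vector [- (p $ 2), 0, 0]]"
begin

text \<open>A directional derivative, as in the recursion of \<open>C_k_on\<close>:
  differentiability of \<open>f'\<close> can then be read off from
  \<open>C_k_on 2 UNIV f\<close>.\<close>

definition f' :: "real \<Rightarrow> real" where
  "f' x = frechet_derivative f (at x) 1"

definition f'' :: "real \<Rightarrow> real" where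
  "f'' x = frechet_derivative f' (at x) 1"

lemma C_k_on_f: "C_k_on k UNIV f"
  using f_smooth by (simp add: smooth_on_def)

lemma f_has_derivative: "(f has_real_derivative f' x) (at x)"
proof -
  have d: "(f has_derivative frechet_derivative f (at x)) (at x)"
    using C_k_on_f[of 1] by (simp flip: frechet_derivative_works)
  then obtain c where "(f has_real_derivative c) (at x)"
    using real_differentiable_def differentiable_def by blast
  with d show ?thesis
    by (simp add: f'_def has_field_derivative_def frechet_derivative_eqI)
qed

lemma f'_has_derivative: "(f' has_real_derivative f'' x) (at x)"
proof -
  have "f' differentiable (at x)"
    using C_k_on_f[of 2] by (simp add: f'_def[abs_def] numeral_2_eq_2)
  then obtain c where "(f' has_real_derivative c) (at x)"
    using real_differentiable_def differentiable_def by blast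
  then show ?thesis
    by (simp add: f''_def has_field_derivative_def frechet_derivative_eqI)
qed

lemmas derivative_rules [derivative_intros] =
  DERIV_compose_FDERIV[OF f_has_derivative]
  DERIV_compose_FDERIV[OF f'_has_derivative]

section \<open>Smoothness of the structure tensors\<close>

lemma C_k_on_F: "C_k_on k UNIV (\<lambda>p. F (p $ 1) (p $ 2) (p $ 3))"
proof -
  have "C_k_on k UNIV (\<lambda>p. \<alpha> * exp (2 * (p $ 3)))"
    by (intro C_k_on_bounded_linear_comp[OF bounded_linear_mult_right]
        C_k_on_comp_bounded_linear[OF _ C_k_on_exp]
        bounded_linear_const_mult bounded_linear_vec_nth)
  moreover have "C_k_on k UNIV (\<lambda>p. \<beta> * (p $ 2))"
    by (intro C_k_on_bounded_linear bounded_linear_const_mult bounded_linear_vec_nth)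
  moreover have "C_k_on k UNIV (\<lambda>p. f (p $ 1))"
    by (rule C_k_on_comp_bounded_linear[OF bounded_linear_vec_nth C_k_on_f])
  ultimately show ?thesis
    unfolding F by (intro C_k_on_add C_k_on_const)
qed

lemma C_k_on_coord: "C_k_on k UNIV (\<lambda>p :: real^3. c * p $ i)"
  by (intro C_k_on_bounded_linear bounded_linear_const_mult bounded_linear_vec_nth)

lemma smooth_g: "smooth_on UNIV g"
  unfolding smooth_on_def
proof
  fix k
  have "C_k_on k UNIV (\<lambda>p. g p $ i $ j)" for i j
  proof -
    have "\<forall>i j. C_k_on k UNIV (\<lambda>p. g p $ i $ j)"
      using C_k_on_bounded_linear_comp[OF bounded_linear_mult_right[of "1/4"] C_k_on_F]
        C_k_on_coord[of k "-1/4" 2]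
      by (simp add: forall_3 g C_k_on_const)
    then show ?thesis by blast
  qed
  then show "C_k_on k UNIV g"
    by (intro C_k_on_vec_componentwise)
qed

lemma smooth_\<xi>: "smooth_on UNIV \<xi>"
  using C_k_on_const unfolding smooth_on_def \<xi>[abs_def] by blast

lemma smooth_\<eta>: "smooth_on UNIV \<eta>"
  unfolding smooth_on_def
proof
  fix k
  have "\<forall>i. C_k_on k UNIV (\<lambda>p. \<eta> p $ i)"
    using C_k_on_coord[of k "-1/2" 2]
    by (simp add: forall_3 \<eta> C_k_on_const)
  then show "C_k_on k UNIV \<eta>"
    by (intro C_k_on_vec_componentwise) blast
qed

lemma smooth_\<phi>: "smooth_on UNIV \<phi>"
  unfolding smooth_on_def
proof
  fix k
  have "C_k_on k UNIV (\<lambda>p. - ((p :: real^3) $ 2)\<^sup>2)"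
    by (intro C_k_on_bounded_linear_comp[OF bounded_linear_minus[OF bounded_linear_ident]]
       C_k_on_comp_bounded_linear[OF bounded_linear_vec_nth C_k_on_power2])
  from C_k_on_add[OF C_k_on_F this] have "\<forall>i j. C_k_on k UNIV (\<lambda>p. \<phi> p $ i $ j)"
      using C_k_on_coord[of k "-1" 2]
      by (simp add: forall_3 \<phi> C_k_on_const)
  then show "C_k_on k UNIV \<phi>"
    by (intro C_k_on_vec_componentwise) blast
qed

section \<open>Component formulas and the algebraic identities\<close>

lemma g_app: "bil_app g p v w = (F (p$1) (p$2) (p$3) * v$1 * w$1 + v$1 * w$2 + v$2 * w$1
    - p$2 * (v$1 * w$3 + v$3 * w$1) + v$3 * w$3) / 4"
  by (simp add: bil_app_def g inner_vec_def matrix_vector_mult_def sum_3 algebra_simps)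

lemma \<eta>_app: "form_app \<eta> p v = (v$3 - p$2 * v$1) / 2"
  by (simp add: form_app_def \<eta> inner_vec_def sum_3 algebra_simps)

lemma \<phi>_app: "\<phi> p *v v = vector [- (v$1), (F (p$1) (p$2) (p$3) - (p$2)\<^sup>2) * v$1 + v$2, - (p$2 * v$1)]"
  by (simp add: \<phi> vec_eq_iff forall_3 matrix_vector_mult_def sum_3)

lemma g_inverse: "g p ** (4 *\<^sub>R vector [vector [0, 1, 0],
    vector [1, (p$2)\<^sup>2 - F (p$1) (p$2) (p$3), p$2], vector [0, p$2, 1]]) = mat 1"
  by (simp add: g matrix_matrix_mult_def vec_eq_iff forall_3 sum_3 mat_def power2_eq_square algebra_simps)

lemma pseudo_riemannian: "pseudo_riemannian g"
  unfolding pseudo_riemannian_def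
proof (intro conjI allI smooth_g)
  show "transpose (g p) = g p" for p
    by (simp add: transpose_def vec_eq_iff forall_3 g)
  show "invertible (g p)" for p
    using g_inverse invertible_right_inverse by blast
qed

lemma almost_paracontact: "almost_paracontact \<phi> \<xi> \<eta>"
  unfolding almost_paracontact_def
proof (intro conjI allI smooth_\<phi> smooth_\<xi> smooth_\<eta>)
  fix p :: "real^3"
  \<comment> \<open>Solving \<open>\<phi> p *v v = - v\<close> gives \<open>v$3 = y * v$1\<close>
    and \<open>2 * v$2 = (y^2 - F) * v$1\<close> with \<open>y = p$2\<close>. The choice
    \<open>v$1 = 2\<close> clears the fraction, so a general solution is \<open>v$1 / 2\<close>
    times \<open>?w\<close>.\<close>
  let ?w = "vector [2, (p$2)\<^sup>2 - F (p$1) (p$2) (p$3), 2 * p$2] :: real^3"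
  have "{v. form_app \<eta> p v = 0 \<and> \<phi> p *v v = v} = range (\<lambda>c. c *\<^sub>R axis 2 1)"
    by (auto simp: \<phi>_app \<eta>_app vec_eq_iff forall_3 image_iff axis_def)
  then show "dim {v. form_app \<eta> p v = 0 \<and> \<phi> p *v v = v} = 1"
    by (intro dim_eq_1I[of "axis 2 1"]) auto
  have "{v. form_app \<eta> p v = 0 \<and> \<phi> p *v v = - v} = range (\<lambda>c. c *\<^sub>R ?w)"
    by (auto simp: \<phi>_app \<eta>_app vec_eq_iff forall_3 image_iff algebra_simps intro!: exI[of _ "_ $ 1 / 2"])
  moreover have "?w \<noteq> 0" by (simp add: vec_eq_iff forall_3)
  ultimately show "dim {v. form_app \<eta> p v = 0 \<and> \<phi> p *v v = - v} = 1"
    using dim_eq_1I by blast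
qed (simp_all add: \<phi>_app \<eta>_app \<xi> vec_eq_iff forall_3 field_simps)

text \<open>The derivatives of the components of \<open>X\<close> and \<open>Y\<close> cancel
  against the Lie bracket. Both sides equal a quarter of \<open>X$1 * Y$2 - X$2 * Y$1\<close>,
  evaluated at \<open>p\<close>.\<close>

lemma ext_deriv_\<eta>:
  assumes "X differentiable (at p)" "Y differentiable (at p)"
  shows "ext_deriv \<eta> X Y p = bil_app g p (X p) (\<phi> p *v Y p)"
proof -
  define X' Y' where "X' = frechet_derivative X (at p)" and "Y' = frechet_derivative Y (at p)"
  have X: "((\<lambda>q. X q $ i) has_derivative (\<lambda>h. X' h $ i)) (at p)"
    and Y: "((\<lambda>q. Y q $ i) has_derivative (\<lambda>h. Y' h $ i)) (at p)" for i
    using assms unfolding X'_def Y'_def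
    by (auto simp: frechet_derivative_works intro: bounded_linear.has_derivative[OF bounded_linear_vec_nth])
  have "frechet_derivative (\<lambda>q. (Y q $ 3 - q $ 2 * Y q $ 1) / 2) (at p)
     = (\<lambda>h. (Y' h $ 3 - (p $ 2 * Y' h $ 1 + h $ 2 * Y p $ 1)) / 2)"
    by (rule frechet_derivative_eqI)
       (auto intro!: derivative_eq_intros X Y bounded_linear.has_derivative[OF bounded_linear_vec_nth])
  moreover have "frechet_derivative (\<lambda>q. (X q $ 3 - q $ 2 * X q $ 1) / 2) (at p)
     = (\<lambda>h. (X' h $ 3 - (p $ 2 * X' h $ 1 + h $ 2 * X p $ 1)) / 2)"
    by (rule frechet_derivative_eqI)
       (auto intro!: derivative_eq_intros X Y bounded_linear.has_derivative[OF bounded_linear_vec_nth])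
  ultimately show ?thesis
    unfolding ext_deriv_def vf_deriv_def lie_bracket_def g_app \<phi>_app \<eta>_app
    by (simp add: field_simps power2_eq_square flip: X'_def Y'_def)
qed

lemma paracontact_metric: "paracontact_metric \<phi> \<xi> \<eta> g"
  unfolding paracontact_metric_def
proof (intro conjI allI impI almost_paracontact pseudo_riemannian ext_deriv_\<eta>)
  show "bil_app g p (\<phi> p *v v) (\<phi> p *v w) = - bil_app g p v w + form_app \<eta> p v * form_app \<eta> p w"
    for p v w
    by (simp add: g_app \<phi>_app \<eta>_app field_simps power2_eq_square)
qed (auto intro: smooth_on_differentiable)

subsection \<open>The Ricci soliton equation\<close>

text \<open>The derivative of \<open>g\<close> at \<open>p\<close> in direction
  \<open>h\<close>.\<close>

definition dg :: "real^3 \<Rightarrow> real^3 \<Rightarrow> real^3^3" where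
  "dg p h = (1/4) *\<^sub>R vector
     [vector [f' (p$1) * h$1 + \<beta> * h$2 + 2 * \<alpha> * exp (2 * p$3) * h$3, 0, - (h$2)],
      vector [0, 0, 0],
      vector [- (h$2), 0, 0]]"

lemma g_has_derivative: "((\<lambda>q. g q $ i $ j) has_derivative (\<lambda>h. dg p h $ i $ j)) (at p)"
proof -
  have "\<forall>i j. ((\<lambda>q. g q $ i $ j) has_derivative (\<lambda>h. dg p h $ i $ j)) (at p)"
    by (simp add: forall_3 g dg_def F)
       (auto intro!: derivative_eq_intros derivative_rules bounded_linear.has_derivative[OF bounded_linear_vec_nth])
  then show ?thesis by blast
qed

text \<open>Since \<open>\<xi>\<close> is constant, the bracket terms cancel the derivatives of
  \<open>X\<close> and \<open>Y\<close>; what remains is \<open>dg\<close> in direction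
  \<open>\<xi>\<close>.\<close>

lemma lie_deriv_\<xi>_g:
  assumes "X differentiable (at p)" "Y differentiable (at p)"
  shows "lie_deriv \<xi> g X Y p = \<alpha> * exp (2 * p$3) * X p $ 1 * Y p $ 1"
proof -
  define X' Y' where "X' = frechet_derivative X (at p)" and "Y' = frechet_derivative Y (at p)"
  have X: "((\<lambda>q. X q $ i) has_derivative (\<lambda>h. X' h $ i)) (at p)"
    and Y: "((\<lambda>q. Y q $ i) has_derivative (\<lambda>h. Y' h $ i)) (at p)" for i
    using assms unfolding X'_def Y'_def
    by (auto simp: frechet_derivative_works intro: bounded_linear.has_derivative[OF bounded_linear_vec_nth])
  have "frechet_derivative (\<lambda>q. bil_app g q (X q) (Y q)) (at p)
     = (\<lambda>h. \<Sum>i\<in>UNIV. X p $ i * (\<Sum>j\<in>UNIV. g p $ i $ j * Y' h $ j + dg p h $ i $ j * Y p $ j)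
           + X' h $ i * (\<Sum>j\<in>UNIV. g p $ i $ j * Y p $ j))"
    unfolding bil_app_def inner_vec_def matrix_vector_mult_def vec_lambda_beta
    by (rule frechet_derivative_eqI)
       (auto intro!: derivative_eq_intros X Y g_has_derivative)
  moreover have "frechet_derivative \<xi> (at p) = (\<lambda>_. 0)"
    by (simp add: \<xi>[abs_def])
  ultimately show ?thesis
    unfolding lie_deriv_def lie_bracket_def vf_deriv_def X'_def[symmetric] Y'_def[symmetric]
    by (simp add: g_app sum_3 g dg_def \<xi> field_simps)
qed

text \<open>The Christoffel symbols of \<open>g\<close>, upper index first. Here \<open>Z\<close> is
  the partial derivative of \<open>F\<close> in \<open>z\<close>, and \<open>u\<close> is, up to the
  factor 4, the middle diagonal entry of the inverse metric.\<close>

definition Gam :: "real^3 \<Rightarrow> real^3^3^3" where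
  "Gam p = (let y = p$2; Z = 2 * \<alpha> * exp (2 * p$3); u = y\<^sup>2 - F (p$1) (p$2) (p$3) in
    (1/2) *\<^sub>R vector
     [vector [vector [- \<beta>, 0, 1], vector [0, 0, 0], vector [1, 0, 0]],
      vector [vector [f' (p$1) - \<beta> * u - y * Z, \<beta> - y, Z + u],
              vector [\<beta> - y, 0, - 1],
              vector [Z + u, - 1, 0]],
      vector [vector [- y * \<beta> - Z, - 1, y], vector [- 1, 0, 0], vector [y, 0, 0]]])"

text \<open>The derivative of \<open>Gam\<close> in direction \<open>h\<close>; a primed letter is
  the derivative of the unprimed one. The first block vanishes because that block of
  \<open>Gam\<close> is constant.\<close>

definition dGam :: "real^3 \<Rightarrow> real^3 \<Rightarrow> real^3^3^3" where
  "dGam p h = (let y = p$2; y' = h$2; Z = 2 * \<alpha> * exp (2 * p$3); Z' = 2 * Z * h$3;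
       u = y\<^sup>2 - F (p$1) (p$2) (p$3); u' = 2 * y * y' - (f' (p$1) * h$1 + \<beta> * y' + Z * h$3) in
    (1/2) *\<^sub>R vector
     [0,
      vector [vector [f'' (p$1) * h$1 - \<beta> * u' - (y * Z' + y' * Z), - y', Z' + u'],
              vector [- y', 0, 0],
              vector [Z' + u', 0, 0]],
      vector [vector [- y' * \<beta> - Z', 0, y'], vector [0, 0, 0], vector [y', 0, 0]]])"

lemma Gam_has_derivative:
  "((\<lambda>q. Gam q $ a $ i $ j) has_derivative (\<lambda>h. dGam p h $ a $ i $ j)) (at p)"
proof -
  have "\<forall>a i j. ((\<lambda>q. Gam q $ a $ i $ j) has_derivative (\<lambda>h. dGam p h $ a $ i $ j)) (at p)"
    by (simp add: forall_3 Gam_def dGam_def F Let_def)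
       (auto intro!: derivative_eq_intros derivative_rules bounded_linear.has_derivative[OF bounded_linear_vec_nth]
         simp: fun_eq_iff field_simps)
  then show ?thesis by blast
qed

lemma christoffel_eq: "christoffel g p a i j = Gam p $ a $ i $ j"
proof -
  have "\<forall>a i j. christoffel g p a i j = Gam p $ a $ i $ j"
    unfolding christoffel_def vf_deriv_def frechet_derivative_eqI[OF g_has_derivative]
      matrix_inv_eqI[OF g_inverse]
    by (simp add: forall_3 sum_3 dg_def Gam_def Let_def coord_vf_def axis_def field_simps)
  then show ?thesis by blast
qed

lemma levi_civita_coord:
  "levi_civita g (coord_vf i) Y p $ a
     = frechet_derivative Y (at p) (axis i 1) $ a + (\<Sum>j\<in>UNIV. Gam p $ a $ i $ j * Y p $ j)"
  by (simp add: levi_civita_def christoffel_eq coord_vf_def axis_def if_distrib sum.If_cases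
      if_distribR cong: if_cong)

lemma levi_civita_coord_coord:
  "levi_civita g (coord_vf i) (coord_vf j) = (\<lambda>p. \<chi> a. Gam p $ a $ i $ j)"
  by (rule ext) (simp add: vec_eq_iff levi_civita_coord, simp add: coord_vf_def axis_def if_distrib cong: if_cong)

text \<open>Coordinate fields commute, so the bracket term drops out and the classical formula in
  Christoffel symbols remains.\<close>

lemma curvature_coord:
  "curvature g (coord_vf i) (coord_vf j) (coord_vf k) p $ a
    = dGam p (axis i 1) $ a $ j $ k - dGam p (axis j 1) $ a $ i $ k
     + (\<Sum>m\<in>UNIV. Gam p $ a $ i $ m * Gam p $ m $ j $ k - Gam p $ a $ j $ m * Gam p $ m $ i $ k)"
proof -
  have D: "frechet_derivative (\<lambda>p. \<chi> a. Gam p $ a $ j $ k) (at p) = (\<lambda>h. \<chi> a. dGam p h $ a $ j $ k)" for j k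
    by (intro frechet_derivative_eqI has_derivative_vec_componentwise) (simp add: Gam_has_derivative)
  have "lie_bracket (coord_vf i) (coord_vf j) = (\<lambda>_. 0)"
    by (rule ext) (simp add: lie_bracket_def coord_vf_def)
  moreover have "levi_civita g (\<lambda>_. 0) Y p = 0" if "Y = coord_vf k" for Y
    using that by (simp add: levi_civita_def coord_vf_def vec_eq_iff)
  ultimately show ?thesis
    by (simp add: curvature_def levi_civita_coord levi_civita_coord_coord D sum_subtractf)
qed

text \<open>Contraction of \<open>curvature_coord\<close>, checked entry by entry. The second term
  is the one that \<open>lie_deriv_\<xi>_g\<close> cancels.\<close>

lemma ricci_eq:
  "ricci g p = - 2 *\<^sub>R g p - (\<chi> j k. if j = 1 \<and> k = 1 then \<alpha> * exp (2 * p$3) else 0)"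
proof -
  have "\<forall>j k. ricci g p $ j $ k = (- 2 *\<^sub>R g p - (\<chi> j k. if j = 1 \<and> k = 1 then \<alpha> * exp (2 * p$3) else 0)) $ j $ k"
    unfolding ricci_def trace_def vec_lambda_beta curvature_coord sum_3
    by (simp add: forall_3 Gam_def dGam_def Let_def g axis_def field_simps power2_eq_square)
  then show ?thesis by (simp add: vec_eq_iff)
qed

lemma soliton: "paracontact_ricci_soliton \<phi> \<xi> \<eta> g"
  unfolding paracontact_ricci_soliton_def
proof (intro conjI paracontact_metric exI[of _ "- 2"] allI impI)
  fix X Y :: vec_field and p assume "smooth_on UNIV X" "smooth_on UNIV Y"
  then have "lie_deriv \<xi> g X Y p = \<alpha> * exp (2 * p$3) * X p $ 1 * Y p $ 1"
    by (intro lie_deriv_\<xi>_g smooth_on_differentiable)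
  moreover have "bil_app (ricci g) p (X p) (Y p) = - 2 * bil_app g p (X p) (Y p) - \<alpha> * exp (2 * p$3) * X p $ 1 * Y p $ 1"
    by (simp add: bil_app_def ricci_eq inner_vec_def matrix_vector_mult_def sum_3 algebra_simps)
  ultimately show "lie_deriv \<xi> g X Y p + bil_app (ricci g) p (X p) (Y p) = - 2 * bil_app g p (X p) (Y p)"
    by simp
qed

subsection \<open>Isometries preserving the contact form\<close>

text \<open>Testing against the second, third and first axis yields \<open>v$1 = 0\<close>,
  \<open>v$3 = 0\<close> and \<open>v$2 = 0\<close> in turn.\<close>

lemma g_nondegenerate:
  assumes "\<And>w. bil_app g p v w = 0"
  shows "v = 0"
  using assms[of "axis 1 1"] assms[of "axis 2 1"] assms[of "axis 3 1"]
  by (simp add: g_app axis_def vec_eq_iff forall_3)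

text \<open>The coefficient of \<open>dx\<^sup>2\<close> in \<open>4 (g - \<eta> \<otimes> \<eta>)\<close>.\<close>

definition Q :: "real^3 \<Rightarrow> real" where
  "Q p = F (p$1) (p$2) (p$3) - (p$2)\<^sup>2"

text \<open>Splits off the part that a map preserving \<open>\<eta>\<close> respects anyway; the
  isometry condition then concerns only the first two components of vectors.\<close>

lemma g_app_Q:
  "bil_app g p v w = (Q p * v$1 * w$1 + v$1 * w$2 + v$2 * w$1) / 4 + form_app \<eta> p v * form_app \<eta> p w"
  by (simp add: g_app Q_def \<eta>_app field_simps power2_eq_square)

text \<open>\<open>J x\<close> is the derivative of \<open>\<Phi>\<close> at \<open>x\<close>.
  Convexity of \<open>S\<close> allows integration along the coordinate lines inside
  \<open>S\<close>.\<close>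

context
  fixes S :: "(real^3) set" and \<Phi> :: vec_field and J :: "real^3 \<Rightarrow> real^3 \<Rightarrow> real^3"
  assumes S: "open S" "convex S"
    and J: "\<And>x. x \<in> S \<Longrightarrow> (\<Phi> has_derivative J x) (at x)"
    and isometry_g: "\<And>x v w. x \<in> S \<Longrightarrow> bil_app g (\<Phi> x) (J x v) (J x w) = bil_app g x v w"
    and isometry_\<eta>: "\<And>x v. x \<in> S \<Longrightarrow> form_app \<eta> (\<Phi> x) (J x v) = form_app \<eta> x v"
begin

text \<open>The vector \<open>axis 3 1\<close> is half of \<open>\<xi>\<close> and is
  \<open>g\<close>-dual to half of \<open>\<eta>\<close>. Hence
  \<open>J x (axis 3 1) - axis 3 1\<close> is orthogonal to the range of \<open>J x\<close>, which
  is the whole space because an isometry is injective.\<close>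

lemma J_axis_3:
  assumes "x \<in> S"
  shows "J x (axis 3 1) = axis 3 1"
proof -
  have lin: "linear (J x)"
    using J[OF assms] by (rule has_derivative_linear)
  have "v = 0" if "J x v = 0" for v
    using isometry_g[OF assms, of v] that by (intro g_nondegenerate[of x]) (simp add: bil_app_def)
  then have surj: "surj (J x)"
    using lin by (intro linear_injective_imp_surjective) (auto simp: linear_injective_0)
  have eq: "bil_app g (\<Phi> x) (J x (axis 3 1) - axis 3 1) (J x v) = 0" for v
  proof -
    have axis_3: "bil_app g p (axis 3 1) u = form_app \<eta> p u / 2" for p u
      by (simp add: g_app \<eta>_app axis_def field_simps)
    have "bil_app g (\<Phi> x) (J x (axis 3 1) - axis 3 1) (J x v)
        = bil_app g (\<Phi> x) (J x (axis 3 1)) (J x v) - bil_app g (\<Phi> x) (axis 3 1) (J x v)"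
      by (simp add: bil_app_def inner_diff_left)
    also have "\<dots> = 0"
      unfolding isometry_g[OF assms] axis_3 isometry_\<eta>[OF assms] by simp
    finally show ?thesis .
  qed
  have "J x (axis 3 1) - axis 3 1 = 0"
  proof (rule g_nondegenerate)
    fix w
    obtain v where "w = J x v"
      using surj by (rule surjE)
    then show "bil_app g (\<Phi> x) (J x (axis 3 1) - axis 3 1) w = 0"
      by (simp only: eq)
  qed
  then show ?thesis by simp
qed

lemma \<Phi>_vertical:
  assumes "x \<in> S" "x + t *\<^sub>R axis 3 1 \<in> S"
  shows "\<Phi> (x + t *\<^sub>R axis 3 1) = \<Phi> x + t *\<^sub>R axis 3 1"
proof (rule affine_along_line[OF S(2) assms])
  show "(\<Phi> has_derivative J y) (at y)" if "y \<in> S" for y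
    using that by (rule J)
  show "J (x + r *\<^sub>R axis 3 1) (axis 3 1) = axis 3 1" if "x + r *\<^sub>R axis 3 1 \<in> S" for r
    using that by (rule J_axis_3)
qed

text \<open>Differentiates the equivariance under vertical translations.\<close>

lemma J_vertical:
  assumes "x \<in> S" "x + t *\<^sub>R axis 3 1 \<in> S"
  shows "J (x + t *\<^sub>R axis 3 1) = J x"
  using S J \<Phi>_vertical assms by (intro derivative_translate[of S _ _ \<Phi>]) auto

lemma isometry_Q:
  assumes "x \<in> S"
  shows "Q (\<Phi> x) * J x v $ 1 * J x w $ 1 + J x v $ 1 * J x w $ 2 + J x v $ 2 * J x w $ 1
    = Q x * v$1 * w$1 + v$1 * w$2 + v$2 * w$1"
  using isometry_g[OF assms, of v w] by (simp add: g_app_Q isometry_\<eta>[OF assms])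

text \<open>Along the vertical line through \<open>x\<close> all terms but the exponential ones are constant.\<close>

lemma isometry_dx:
  assumes "x \<in> S"
  shows "exp (2 * \<Phi> x $ 3) * (J x v $ 1 * J x w $ 1) = exp (2 * x $ 3) * (v$1 * w$1)"
proof -
  obtain t :: real where t: "t \<noteq> 0" "x + t *\<^sub>R axis 3 1 \<in> S"
    using open_translate_nonzero S assms by blast
  have Q: "Q (p + t *\<^sub>R axis 3 1) = Q p + \<alpha> * (exp (2 * t) - 1) * exp (2 * p $ 3)" for p
    by (simp add: Q_def F axis_def algebra_simps flip: exp_add)
  have "\<alpha> * (exp (2 * t) - 1) * (exp (2 * \<Phi> x $ 3) * (J x v $ 1 * J x w $ 1))
      = \<alpha> * (exp (2 * t) - 1) * (exp (2 * x $ 3) * (v$1 * w$1))"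
    using isometry_Q[OF assms, of v w] isometry_Q[OF t(2), of v w]
    unfolding \<Phi>_vertical[OF assms t(2)] J_vertical[OF assms t(2)] Q
    by (simp add: algebra_simps)
  \<comment> \<open>The common factor is nonzero because \<open>t\<close> and
    \<open>\<alpha>\<close> are.\<close>
  then show ?thesis
    using t \<alpha>_nonzero by simp
qed

section \<open>The derivative of the isometry in the directions of \<open>x\<close> and
  \<open>y\<close>\<close>

lemma J_axis_1:
  assumes "x \<in> S"
  shows "J x (axis 1 1) $ 3 - \<Phi> x $ 2 * J x (axis 1 1) $ 1 = - x $ 2"
  using isometry_\<eta>[OF assms, of "axis 1 1"] by (simp add: \<eta>_app axis_def)

text \<open>In turn: \<open>isometry_dx\<close> makes the square of the first component zero,
  preservation of \<open>\<eta>\<close> then kills the third, and \<open>isometry_Q\<close> on the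
  first two axes reduces to the product.\<close>

lemma J_axis_2:
  assumes "x \<in> S"
  shows "J x (axis 2 1) $ 1 = 0" "J x (axis 2 1) $ 3 = 0"
    "J x (axis 1 1) $ 1 * J x (axis 2 1) $ 2 = 1"
proof -
  show 1: "J x (axis 2 1) $ 1 = 0"
    using isometry_dx[OF assms, of "axis 2 1" "axis 2 1"] by (simp add: axis_def)
  show "J x (axis 2 1) $ 3 = 0"
    using isometry_\<eta>[OF assms, of "axis 2 1"] 1 by (simp add: \<eta>_app axis_def)
  show "J x (axis 1 1) $ 1 * J x (axis 2 1) $ 2 = 1"
    using isometry_Q[OF assms, of "axis 1 1" "axis 2 1"] 1 by (simp add: axis_def)
qed

lemma J_comp: "x \<in> S \<Longrightarrow> ((\<lambda>y. \<Phi> y $ i) has_derivative (\<lambda>v. J x v $ i)) (at x)"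
  using J by (rule bounded_linear.has_derivative[OF bounded_linear_vec_nth])

lemma \<Phi>_axis_2:
  assumes "x \<in> S" "x + s *\<^sub>R axis 2 1 \<in> S"
  shows "\<Phi> (x + s *\<^sub>R axis 2 1) $ 1 = \<Phi> x $ 1" "\<Phi> (x + s *\<^sub>R axis 2 1) $ 3 = \<Phi> x $ 3"
  using affine_along_line[OF S(2) assms J_comp[of _ 1], of 0]
    affine_along_line[OF S(2) assms J_comp[of _ 3], of 0] J_axis_2 by auto

text \<open>The first component of \<open>\<Phi>\<close> is constant along \<open>y\<close>-lines,
  hence its derivative is invariant under such translations. The second equation follows from the
  product in \<open>J_axis_2\<close>.\<close>

lemma J_axis_2_translate:
  assumes "x \<in> S" "x + s *\<^sub>R axis 2 1 \<in> S"
  shows "J (x + s *\<^sub>R axis 2 1) v $ 1 = J x v $ 1"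
    "J (x + s *\<^sub>R axis 2 1) (axis 2 1) $ 2 = J x (axis 2 1) $ 2"
proof -
  have *: "J (x + s *\<^sub>R axis 2 1) v $ 1 = J x v $ 1" for v
    using derivative_translate[OF S(1) assms J_comp[of _ 1], of 0] \<Phi>_axis_2(1)
    by (auto simp: fun_eq_iff)
  then show "J (x + s *\<^sub>R axis 2 1) v $ 1 = J x v $ 1" .
  show "J (x + s *\<^sub>R axis 2 1) (axis 2 1) $ 2 = J x (axis 2 1) $ 2"
    using J_axis_2(3)[OF assms(1)] J_axis_2(3)[OF assms(2)] *[of "axis 1 1"]
    by (metis mult_cancel_left zero_neq_one mult_zero_left)
qed

lemma \<Phi>_axis_2_comp_2:
  assumes "x \<in> S" "x + s *\<^sub>R axis 2 1 \<in> S"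
  shows "\<Phi> (x + s *\<^sub>R axis 2 1) $ 2 = \<Phi> x $ 2 + s * J x (axis 2 1) $ 2"
  using affine_along_line[OF S(2) assms J_comp[of _ 2] J_axis_2_translate(2)[OF assms(1)]] by simp

text \<open>The \<open>dx^2\<close> coefficient of the metric is compared at \<open>x\<close> and at
  \<open>x + ?w\<close>. The unknown in this comparison is the change \<open>b' - b\<close> of the
  \<open>x\<close>-derivative of the second component; it is found by differentiating
  \<open>?K\<close>.\<close>

lemma height_preserved:
  assumes x: "x \<in> S" and "\<beta> \<noteq> 0"
  shows "\<Phi> x $ 3 = x $ 3"
proof -
  obtain s :: real where s: "s \<noteq> 0" "x + s *\<^sub>R axis 2 1 \<in> S"
    using open_translate_nonzero S x by blast
  let ?w = "s *\<^sub>R axis 2 1 :: real^3"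
  let ?K = "\<lambda>y. J y (axis 2 1) $ 2"
  define a b b' c k where "a = J x (axis 1 1) $ 1" and "b = J x (axis 1 1) $ 2"
    and "b' = J (x + ?w) (axis 1 1) $ 2" and "c = J x (axis 1 1) $ 3" and "k = ?K x"
  note defs = this
  have ak: "a * k = 1" and c: "c - \<Phi> x $ 2 * a = - x $ 2"
    using J_axis_2(3)[OF x] J_axis_1[OF x] by (auto simp: defs)

  \<comment> \<open>As the second component of \<open>\<Phi>\<close> is affine along
    \<open>y\<close>-lines, \<open>?K\<close> equals its difference quotient with the fixed step
    \<open>s\<close>. It is therefore differentiable without second derivatives of
    \<open>\<Phi>\<close>.\<close>
  have K: "(?K has_derivative (\<lambda>v. (J (x + ?w) v $ 2 - J x v $ 2) / s)) (at x)"
  proof -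
    let ?T = "S \<inter> (\<lambda>y. y + ?w) -` S"
    have "open ?T"
      using S by (intro open_Int open_vimage continuous_intros) auto
    have "((\<lambda>y. \<Phi> (y + ?w) $ 2) has_derivative (\<lambda>v. J (x + ?w) v $ 2)) (at x)"
      by (rule has_derivative_translate_arg[OF J_comp[OF s(2)]])
    then have "((\<lambda>y. (\<Phi> (y + ?w) $ 2 - \<Phi> y $ 2) / s) has_derivative
        (\<lambda>v. (J (x + ?w) v $ 2 - J x v $ 2) / s)) (at x)"
      using s J_comp[OF x] by (auto intro!: derivative_eq_intros)
    then show ?thesis
      by (rule has_derivative_transform_within_open[OF _ \<open>open ?T\<close>])
        (use x s \<Phi>_axis_2_comp_2 in auto)
  qed
  \<comment> \<open>By \<open>J_axis_2\<close>, \<open>?K\<close> is the reciprocal of the factor in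
    \<open>isometry_dx\<close>; squaring avoids a choice of its sign.\<close>
  have K2: "(?K y)\<^sup>2 = exp (2 * \<Phi> y $ 3 - 2 * y $ 3)" if "y \<in> S" for y
  proof -
    have "exp (2 * \<Phi> y $ 3) * (J y (axis 1 1) $ 1)\<^sup>2 = exp (2 * y $ 3)"
      using isometry_dx[OF that, of "axis 1 1" "axis 1 1"] by (simp add: axis_def power2_eq_square)
    then have "exp (2 * \<Phi> y $ 3) * (J y (axis 1 1) $ 1 * ?K y)\<^sup>2 = exp (2 * y $ 3) * (?K y)\<^sup>2"
      by (simp add: power_mult_distrib)
    then show ?thesis
      by (simp add: J_axis_2(3)[OF that] exp_diff field_simps)
  qed
  have "((\<lambda>y. (?K y)\<^sup>2) has_derivative (\<lambda>v. 2 * (J x (axis 2 1) $ 2) * ((J (x + ?w) v $ 2 - J x v $ 2) / s))) (at x)"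
    using K by (auto intro!: derivative_eq_intros)
  moreover have "((\<lambda>y. (?K y)\<^sup>2) has_derivative (\<lambda>v. (?K x)\<^sup>2 * (2 * J x v $ 3 - 2 * v $ 3))) (at x)"
  proof -
    have "((\<lambda>y. exp (2 * \<Phi> y $ 3 - 2 * y $ 3)) has_derivative
        (\<lambda>v. (?K x)\<^sup>2 * (2 * J x v $ 3 - 2 * v $ 3))) (at x)"
      unfolding K2[OF x]
      by (auto intro!: derivative_eq_intros J_comp[OF x] bounded_linear.has_derivative[OF bounded_linear_vec_nth])
    then show ?thesis
      by (rule has_derivative_transform_within_open[OF _ S(1) x]) (simp add: K2)
  qed
  \<comment> \<open>Equating the two derivatives of the square of \<open>?K\<close> on the first
    axis determines \<open>b' - b\<close>.\<close>
  ultimately have "2 * (J x (axis 2 1) $ 2) * ((J (x + ?w) (axis 1 1) $ 2 - J x (axis 1 1) $ 2) / s)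
       = (?K x)\<^sup>2 * (2 * J x (axis 1 1) $ 3 - 2 * (axis 1 1 :: real^3) $ 3)"
    by (rule fun_cong[OF has_derivative_unique])
  then have "2 * k * ((b' - b) / s) = k\<^sup>2 * (2 * c)"
    by (simp add: axis_def defs)
  then have "k * (b' - b) = k * (s * k * c)"
    using s by (simp add: field_simps power2_eq_square)
  moreover have "k \<noteq> 0" using ak by auto
  ultimately have b': "b' = b + s * k * c"
    by simp

  have 1: "Q (\<Phi> x) * a\<^sup>2 + 2 * a * b = Q x"
    using isometry_Q[OF x, of "axis 1 1" "axis 1 1"] by (simp add: axis_def defs power2_eq_square)
  have 2: "Q (\<Phi> (x + ?w)) * a\<^sup>2 + 2 * a * b' = Q (x + ?w)"
    using isometry_Q[OF s(2), of "axis 1 1" "axis 1 1"] J_axis_2_translate(1)[OF x s(2)]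
    by (simp add: axis_def defs power2_eq_square)
  have Qx: "Q (x + ?w) = Q x + \<beta> * s - 2 * x $ 2 * s - s\<^sup>2"
    by (simp add: Q_def F axis_def algebra_simps power2_eq_square)
  have Q\<Phi>: "Q (\<Phi> (x + ?w)) = Q (\<Phi> x) + \<beta> * s * k - 2 * \<Phi> x $ 2 * s * k - s\<^sup>2 * k\<^sup>2"
    using \<Phi>_axis_2[OF x s(2)] \<Phi>_axis_2_comp_2[OF x s(2)]
    by (simp add: Q_def F k_def algebra_simps power2_eq_square)
  \<comment> \<open>The difference of the metric equations \<open>2\<close> and
    \<open>1\<close>.\<close>
  have "(\<beta> * s * k - 2 * \<Phi> x $ 2 * s * k - s\<^sup>2 * k\<^sup>2) * a\<^sup>2 + 2 * a * (s * k * c)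
     = \<beta> * s - 2 * x $ 2 * s - s\<^sup>2"
    using 1 2 unfolding Qx Q\<Phi> b' by (simp add: algebra_simps)
  moreover have "(\<beta> * s * k - 2 * \<Phi> x $ 2 * s * k - s\<^sup>2 * k\<^sup>2) * a\<^sup>2 + 2 * a * (s * k * c)
     = (a * k) * (\<beta> * s * a - 2 * \<Phi> x $ 2 * s * a - s\<^sup>2 * (a * k) + 2 * s * c)"
    by (simp add: algebra_simps power2_eq_square)
  ultimately have "s * (\<beta> * a + 2 * (c - \<Phi> x $ 2 * a)) = s * (\<beta> - 2 * x $ 2)"
    unfolding ak by (simp add: algebra_simps)
  \<comment> \<open>By \<open>c\<close> the terms in \<open>x $ 2\<close> agree on both sides, which
    leaves \<open>\<beta> * a = \<beta>\<close>.\<close>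
  then have "a = 1"
    using s \<open>\<beta> \<noteq> 0\<close> unfolding c by simp
  then have "exp (2 * \<Phi> x $ 3) = exp (2 * x $ 3)"
    using isometry_dx[OF x, of "axis 1 1" "axis 1 1"] by (simp add: axis_def a_def)
  then show ?thesis by simp
qed

end

section \<open>Failure of local homogeneity\<close>

lemma not_locally_homogeneous:
  assumes "\<beta> \<noteq> 0"
  shows "\<not> locally_homogeneous \<eta> g"
proof
  assume "locally_homogeneous \<eta> g"
  \<comment> \<open>The origin and \<open>axis 3 1\<close> lie at different heights.\<close>
  then obtain U \<Phi> where U: "open U" "0 \<in> U" "\<Phi> 0 = axis 3 1" "smooth_on U \<Phi>"
    and iso: "\<forall>x\<in>U. \<forall>v w. bil_app g (\<Phi> x) (frechet_derivative \<Phi> (at x) v) (frechet_derivative \<Phi> (at x) w)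
            = bil_app g x v w"
        "\<forall>x\<in>U. \<forall>v. form_app \<eta> (\<Phi> x) (frechet_derivative \<Phi> (at x) v) = form_app \<eta> x v"
    unfolding locally_homogeneous_def by metis
  \<comment> \<open>A ball supplies the convex domain that \<open>height_preserved\<close>
    requires.\<close>
  obtain e where e: "e > 0" "ball 0 e \<subseteq> U"
    using U open_contains_ball by metis
  have "\<Phi> differentiable (at x)" if "x \<in> U" for x
    using U(4) that by (auto simp: smooth_on_def dest: spec[of _ 1])
  then have D: "(\<Phi> has_derivative frechet_derivative \<Phi> (at x)) (at x)" if "x \<in> U" for x
    using that by (simp flip: frechet_derivative_works)
  have "\<Phi> 0 $ 3 = (0 :: real^3) $ 3"
  proof (rule height_preserved[of "ball 0 e" _ "\<lambda>x. frechet_derivative \<Phi> (at x)"])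
    fix x v w :: "real^3" assume "x \<in> ball 0 e"
    then have x: "x \<in> U" using e by blast
    show "(\<Phi> has_derivative frechet_derivative \<Phi> (at x)) (at x)"
      using x by (rule D)
    show "bil_app g (\<Phi> x) (frechet_derivative \<Phi> (at x) v) (frechet_derivative \<Phi> (at x) w)
        = bil_app g x v w"
      using x iso by blast
    show "form_app \<eta> (\<Phi> x) (frechet_derivative \<Phi> (at x) v) = form_app \<eta> x v"
      using x iso by blast
  qed (use e assms in auto)
  with U(3) show False
    by (simp add: axis_def)
qed

end

theorem theorem4p3:
  fixes f :: "real \<Rightarrow> real" and \<alpha> \<beta> \<gamma> :: real
    and F :: "real \<Rightarrow> real \<Rightarrow> real \<Rightarrow> real"
    and \<phi> :: tensor11 and \<xi> :: vec_field and \<eta> :: one_form and g :: tensor02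
  assumes f_smooth: "smooth_on UNIV f"
    and \<alpha>_nonzero: "\<alpha> \<noteq> 0"
    and F: "\<And>x y z. F x y z = f x + \<alpha> * exp (2 * z) + \<beta> * y + \<gamma>"
    and \<xi>: "\<And>p. \<xi> p = vector [0, 0, 2]"
    and \<eta>: "\<And>p. \<eta> p = (1/2) *\<^sub>R vector [- (p $ 2), 0, 1]"
    and g: "\<And>p. g p = (1/4) *\<^sub>R vector
              [vector [F (p $ 1) (p $ 2) (p $ 3), 1, - (p $ 2)],
               vector [1, 0, 0],
               vector [- (p $ 2), 0, 1]]"
    and \<phi>: "\<And>p. \<phi> p = vector
              [vector [- 1, 0, 0],
               vector [F (p $ 1) (p $ 2) (p $ 3) - (p $ 2)^2, 1, 0],
               vector [- (p $ 2), 0, 0]]"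
  shows "paracontact_ricci_soliton \<phi> \<xi> \<eta> g \<and> (\<beta> \<noteq> 0 \<longrightarrow> \<not> locally_homogeneous \<eta> g)"
proof -
  interpret walker_structure f \<alpha> \<beta> \<gamma> F \<phi> \<xi> \<eta> g
    by unfold_locales fact+
  show ?thesis
    using soliton not_locally_homogeneous by blast
qed

end
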